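(* Suppose that $u$ and $u_n$, $n=1,2,\ldots$, are fuzzy sets in $F_{USC}(\mathbb{R}^m)$. Then the following statements are equivalent. (i) $u_n$ $\Gamma$-converges to $u$. (ii) $\lim_{n\to\infty}[u_n]_\alpha\,(K)=[u]_\alpha$ holds for almost every $\alpha\in(0,1)$. (iii) $\lim_{n\to\infty}[u_n]_\alpha\,(K)=[u]_\alpha$ for all $\alpha\in(0,1)\setminus P(u)$. (iv) $\lim_{n\to\infty}[u_n]_\alpha\,(K)=[u]_\alpha$ holds for all $\alpha\in P$, where $P$ is some dense subset of $(0,1)\setminus P(u)$. (v) $\lim_{n\to\infty}[u_n]_\alpha\,(K)=[u]_\alpha$ holds for all $\alpha\in P$, where $P$ is some countable dense subset of $(0,1)\setminus P(u)$.
   Context: A fuzzy set on $\mathbb{R}^m$ is a function $u:\mathbb{R}^m\to[0,1]$; $F_{USC}(\mathbb{R}^m)$ is the set of all upper semi-continuous ones. For $\alpha\in(0,1]$, $[u]_\alpha=\{x:u(x)\ge\alpha\}$ and $\{u>\alpha\}=\{x:u(x)>\alpha\}$. $P(u)$ is the set of platform points of $u$: those $\alpha\in(0,1)$ with $\overline{\{u>\alpha\}}\subsetneqq[u]_\alpha$. "Almost every" refers to Lebesgue measure. Kuratowski convergence: for sets $C_n$ in a metric space, $\liminf_n C_n$ is the set of $x=\lim_n x_n$ with $x_n\in C_n$ for all sufficiently large $n$, and $\limsup_n C_n$ is the set of $x=\lim_j x_{n_j}$ with $x_{n_j}\in C_{n_j}$ along some subsequence; $\lim_n C_n\,(K)=C$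 means $C=\liminf_n C_n=\limsup_n C_n$ (sets may be empty). The endograph of $u$ is ${\rm end}\,u=\{(x,t)\in\mathbb{R}^m\times[0,1]:u(x)\ge t\}$, and $u_n$ $\Gamma$-converges to $u$ if $\lim_n{\rm end}\,u_n\,(K)={\rm end}\,u$. *)

theory Defs
  imports "HOL-Analysis.Analysis"
begin

definition upper_semicontinuous :: "('a::topological_space \<Rightarrow> real) \<Rightarrow> bool" where
  "upper_semicontinuous u \<longleftrightarrow> (\<forall>x a. u x < a \<longrightarrow> (\<forall>\<^sub>F y in nhds x. u y < a))"

definition F_USC :: "('a::topological_space \<Rightarrow> real) set" where
  "F_USC = {u. range u \<subseteq> {0..1} \<and> upper_semicontinuous u}"

definition alpha_cut :: "('a \<Rightarrow> real) \<Rightarrow> real \<Rightarrow> 'a set" where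
  "alpha_cut u \<alpha> = {x. u x \<ge> \<alpha>}"

definition strict_alpha_cut :: "('a \<Rightarrow> real) \<Rightarrow> real \<Rightarrow> 'a set" where
  "strict_alpha_cut u \<alpha> = {x. u x > \<alpha>}"

definition platform_points :: "('a::topological_space \<Rightarrow> real) \<Rightarrow> real set" where
  "platform_points u = {\<alpha> \<in> {0<..<1}. closure (strict_alpha_cut u \<alpha>) \<subset> alpha_cut u \<alpha>}"

definition Kuratowski_liminf :: "(nat \<Rightarrow> 'a::metric_space set) \<Rightarrow> 'a set" where
  "Kuratowski_liminf C = {x. \<exists>X. (\<forall>\<^sub>F n in sequentially. X n \<in> C n) \<and> X \<longlonglongrightarrow> x}"

definition Kuratowski_limsup :: "(nat \<Rightarrow> 'a::metric_space set) \<Rightarrow> 'a set" where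
  "Kuratowski_limsup C =
    {x. \<exists>r X. strict_mono r \<and> (\<forall>j. X j \<in> C (r j)) \<and> X \<longlonglongrightarrow> x}"

definition Kuratowski_converges :: "(nat \<Rightarrow> 'a::metric_space set) \<Rightarrow> 'a set \<Rightarrow> bool" where
  "Kuratowski_converges C D \<longleftrightarrow> D = Kuratowski_liminf C \<and> D = Kuratowski_limsup C"

definition endograph :: "('a \<Rightarrow> real) \<Rightarrow> ('a \<times> real) set" where
  "endograph u = {(x, t). t \<in> {0..1} \<and> u x \<ge> t}"

(* The Kuratowski limits are taken in the product of the whole space with \<real> instead of [0,1].
   Since [0,1] is closed, limits of points of endographs have second coordinate in [0,1],
   so the limit sets are the same. *)
definition Gamma_converges ::
    "(nat \<Rightarrow> 'a::metric_space \<Rightarrow> real) \<Rightarrow> ('a \<Rightarrow> real) \<Rightarrow> bool" where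
  "Gamma_converges U u \<longleftrightarrow> Kuratowski_converges (\<lambda>n. endograph (U n)) (endograph u)"

definition dense_subset :: "'a::topological_space set \<Rightarrow> 'a set \<Rightarrow> bool" where
  "dense_subset P S \<longleftrightarrow> P \<subseteq> S \<and> S \<subseteq> closure P"

end

theory Submission
  imports Defs
begin

text \<open>
  Convergence of endographs and convergence of level sets are two readings of the same pair of
  pointwise conditions. Say that \<open>u\<close> is a lower bound for \<open>U\<close> if every value below \<open>u x\<close> is
  eventually exceeded by \<open>U n\<close> somewhere in each ball around \<open>x\<close>, and an upper bound if every value
  above \<open>u x\<close> eventually bounds \<open>U n\<close> on all of some ball around \<open>x\<close>. For functions into \<open>[0,1]\<close>,
  \<open>\<Gamma>\<close>-convergence is the conjunction of the two (\<open>Gamma_converges_iff_hypo_bounds\<close>): the first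
  says that the endograph of \<open>u\<close> lies in the lower limit, the second that it contains the upper
  limit.

  The same two conditions, tested at a single height \<open>\<alpha>\<close>, describe the convergence of the
  \<open>\<alpha>\<close>-cuts, apart from one discrepancy: a point with \<open>u x = \<alpha>\<close> belongs to the cut, whereas the
  lower bound speaks only of values strictly below \<open>u x\<close>. If \<open>\<alpha>\<close> is not a platform point of the
  upper semicontinuous \<open>u\<close>, then \<open>x\<close> is a limit of points where \<open>u\<close> exceeds \<open>\<alpha>\<close>, and the
  discrepancy disappears
  (\<open>hypo_bounds_imp_alpha_cut_converges\<close>). Conversely, strict inequalities leave room to move the
  height, so knowing the convergence of the cuts on a dense set of heights is enough
  (\<open>Gamma_converges_if_alpha_cuts_converge_densely\<close>).

  It remains to see that all the sets of heights in question are dense in \<open>(0,1)\<close>. There are only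
  countably many platform points (\<open>countable_platform_points\<close>), since each one is the supremum of
  \<open>u\<close> over a member of a countable base. Hence the platform points form a null set with dense
  complement, a dense subset of that complement is dense in \<open>(0,1)\<close>, and so is every subset of
  full measure.
\<close>

section \<open>Kuratowski limits in terms of balls\<close>

lemma Kuratowski_liminf_iff_ball:
  "x \<in> Kuratowski_liminf C \<longleftrightarrow> (\<forall>e>0. \<forall>\<^sub>F n in sequentially. \<exists>y\<in>C n. dist x y < e)"
proof
  assume "x \<in> Kuratowski_liminf C"
  then obtain X where X: "\<forall>\<^sub>F n in sequentially. X n \<in> C n" "X \<longlonglongrightarrow> x"
    by (auto simp: Kuratowski_liminf_def)
  show "\<forall>e>0. \<forall>\<^sub>F n in sequentially. \<exists>y\<in>C n. dist x y < e"
  proof (intro allI impI)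
    fix e :: real assume "e > 0"
    with X(2) have "\<forall>\<^sub>F n in sequentially. dist (X n) x < e" by (rule tendstoD)
    with X(1) show "\<forall>\<^sub>F n in sequentially. \<exists>y\<in>C n. dist x y < e"
      by eventually_elim (auto simp: dist_commute)
  qed
next
  assume *: "\<forall>e>0. \<forall>\<^sub>F n in sequentially. \<exists>y\<in>C n. dist x y < e"
  \<comment> \<open>A point of \<open>C n\<close> nearest to \<open>x\<close> need not exist; one within \<open>1 / (n + 1)\<close> of the infimal
    distance serves instead.\<close>
  have "\<exists>y\<in>C n. dist x y < infdist x (C n) + 1 / real (Suc n)" if "C n \<noteq> {}" for n
  proof (rule ccontr)
    assume "\<not> ?thesis"
    then have "infdist x (C n) + 1 / real (Suc n) \<le> infdist x (C n)"
      using that by (subst (2) infdist_notempty) (auto intro!: cINF_greatest simp: not_less)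
    then show False by (simp add: field_simps)
  qed
  then have "\<exists>y. C n \<noteq> {} \<longrightarrow> y \<in> C n \<and> dist x y < infdist x (C n) + 1 / real (Suc n)" for n
    by blast
  then obtain X where X: "\<And>n. C n \<noteq> {} \<Longrightarrow> X n \<in> C n"
      "\<And>n. C n \<noteq> {} \<Longrightarrow> dist x (X n) < infdist x (C n) + 1 / real (Suc n)"
    by metis
  have "\<forall>\<^sub>F n in sequentially. C n \<noteq> {}"
    using *[rule_format, OF zero_less_one] by eventually_elim auto
  then have "\<forall>\<^sub>F n in sequentially. X n \<in> C n" by eventually_elim (rule X(1))
  moreover have "X \<longlonglongrightarrow> x"
  proof (rule tendstoI)
    fix e :: real assume "e > 0"
    have "\<forall>\<^sub>F n in sequentially. 1 / real (Suc n) < e / 2"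
      using order_tendstoD(2)[OF LIMSEQ_inverse_real_of_nat, of "e / 2"] \<open>e > 0\<close>
      by (simp add: inverse_eq_divide)
    moreover have "\<forall>\<^sub>F n in sequentially. \<exists>y\<in>C n. dist x y < e / 2"
      using *[rule_format, of "e / 2"] \<open>e > 0\<close> half_gt_zero by blast
    ultimately show "\<forall>\<^sub>F n in sequentially. dist (X n) x < e"
    proof eventually_elim
      case (elim n)
      then obtain y where y: "y \<in> C n" "dist x y < e / 2" by auto
      then have "infdist x (C n) < e / 2" using infdist_le[of y "C n" x] by linarith
      moreover have "dist x (X n) < infdist x (C n) + 1 / real (Suc n)" using X(2) y(1) by blast
      ultimately show ?case using elim(1) unfolding dist_commute[of "X n"] by linarith
    qed
  qed
  ultimately show "x \<in> Kuratowski_liminf C"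
    unfolding Kuratowski_liminf_def by blast
qed

lemma Kuratowski_limsup_iff_ball:
  "x \<in> Kuratowski_limsup C \<longleftrightarrow> (\<forall>e>0. \<exists>\<^sub>F n in sequentially. \<exists>y\<in>C n. dist x y < e)"
proof
  assume "x \<in> Kuratowski_limsup C"
  then obtain r X where r: "strict_mono r" and X: "\<And>j. X j \<in> C (r j)" "X \<longlonglongrightarrow> x"
    by (auto simp: Kuratowski_limsup_def)
  show "\<forall>e>0. \<exists>\<^sub>F n in sequentially. \<exists>y\<in>C n. dist x y < e"
  proof (intro allI impI)
    fix e :: real assume "e > 0"
    then obtain N where N: "\<And>n. n \<ge> N \<Longrightarrow> dist (X n) x < e"
      using tendstoD[OF X(2)] unfolding eventually_sequentially by blast
    have "\<exists>n\<ge>k. \<exists>y\<in>C n. dist x y < e" for k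
      using X(1)[of "max k N"] N[of "max k N"] seq_suble[OF r, of "max k N"]
      by (intro exI[of _ "r (max k N)"]) (auto simp: dist_commute)
    then show "\<exists>\<^sub>F n in sequentially. \<exists>y\<in>C n. dist x y < e"
      by (simp add: frequently_sequentially)
  qed
next
  assume *: "\<forall>e>0. \<exists>\<^sub>F n in sequentially. \<exists>y\<in>C n. dist x y < e"
  define P where "P j n \<longleftrightarrow> (\<exists>y\<in>C n. dist x y < 1 / real (Suc j))" for j n
  have step: "\<exists>n>k. P j n" for j k
    using *[rule_format, of "1 / real (Suc j)"]
    by (auto simp: frequently_sequentially P_def dest!: spec[of _ "Suc k"] simp: Suc_le_eq)
  have "\<exists>r. \<forall>j. P j (r j) \<and> r j < r (Suc j)"
    by (rule dependent_nat_choice) (use step in blast)+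
  then obtain r where r: "\<And>j. P j (r j)" "\<And>j. r j < r (Suc j)" by blast
  from r(1) obtain X where X: "\<And>j. X j \<in> C (r j)" "\<And>j. dist x (X j) < 1 / real (Suc j)"
    unfolding P_def by metis
  have "X \<longlonglongrightarrow> x"
  proof (rule metric_tendsto_imp_tendsto[OF LIMSEQ_inverse_real_of_nat])
    show "\<forall>\<^sub>F j in sequentially. dist (X j) x \<le> dist (inverse (real (Suc j))) 0"
      using X(2) by (intro always_eventually allI)
        (simp add: dist_commute inverse_eq_divide less_imp_le)
  qed
  then show "x \<in> Kuratowski_limsup C"
    unfolding Kuratowski_limsup_def using X(1) r(2) strict_mono_Suc_iff by blast
qed

lemma Kuratowski_converges_iff_subsets:
  "Kuratowski_converges C D \<longleftrightarrow> D \<subseteq> Kuratowski_liminf C \<and> Kuratowski_limsup C \<subseteq> D"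
proof -
  have "Kuratowski_liminf C \<subseteq> Kuratowski_limsup C"
    by (auto simp: Kuratowski_liminf_iff_ball Kuratowski_limsup_iff_ball
        intro!: eventually_frequently)
  then show ?thesis unfolding Kuratowski_converges_def by blast
qed

section \<open>Convergence of endographs\<close>

text \<open>
  These are the two halves of hypograph convergence: the first places \<open>u\<close> below the lower
  hypo-limit of \<open>U\<close>, the second places it above the upper hypo-limit. The heights \<open>s\<close> and \<open>t\<close>
  range over all reals, so that neither condition mentions the interval \<open>[0,1]\<close>.
\<close>

definition hypo_lower_bound :: "(nat \<Rightarrow> 'a::metric_space \<Rightarrow> real) \<Rightarrow> ('a \<Rightarrow> real) \<Rightarrow> bool" where
  "hypo_lower_bound U u \<longleftrightarrow>
    (\<forall>x s e. s < u x \<longrightarrow> 0 < e \<longrightarrow> (\<forall>\<^sub>F n in sequentially. \<exists>y. dist x y < e \<and> s < U n y))"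

definition hypo_upper_bound :: "(nat \<Rightarrow> 'a::metric_space \<Rightarrow> real) \<Rightarrow> ('a \<Rightarrow> real) \<Rightarrow> bool" where
  "hypo_upper_bound U u \<longleftrightarrow>
    (\<forall>x t. u x < t \<longrightarrow> (\<exists>e>0. \<forall>\<^sub>F n in sequentially. \<forall>y. dist x y < e \<longrightarrow> U n y < t))"

lemma dist_Pair_le: "dist (x, s) (y, t) \<le> dist x y + dist s t"
  by (simp add: dist_Pair_Pair sqrt_sum_squares_le_sum)

text \<open>
  Being near \<open>(x, t)\<close> in the product means being near in both coordinates. A point of
  \<open>endograph (U n)\<close> near \<open>(x, u x)\<close> therefore lies at height above any given \<open>s < u x\<close>; in the other
  direction, a point where \<open>U n\<close> exceeds a height slightly below \<open>t\<close> yields a nearby point of the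
  endograph at exactly that height.
\<close>

lemma endograph_subset_liminf_iff:
  assumes "range u \<subseteq> {0..1}" and "\<And>n. range (U n) \<subseteq> {0..1}"
  shows "endograph u \<subseteq> Kuratowski_liminf (\<lambda>n. endograph (U n)) \<longleftrightarrow> hypo_lower_bound U u"
proof
  assume sub: "endograph u \<subseteq> Kuratowski_liminf (\<lambda>n. endograph (U n))"
  show "hypo_lower_bound U u"
    unfolding hypo_lower_bound_def
  proof (intro allI impI)
    fix x s and e :: real assume s: "s < u x" and e: "0 < e"
    have "(x, u x) \<in> Kuratowski_liminf (\<lambda>n. endograph (U n))"
      by (rule subsetD[OF sub]) (use assms(1) in \<open>auto simp: endograph_def image_subset_iff\<close>)
    then have "\<forall>\<^sub>F n in sequentially. \<exists>z\<in>endograph (U n). dist (x, u x) z < min e (u x - s)"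
      using s e unfolding Kuratowski_liminf_iff_ball
      by (elim allE[of _ "min e (u x - s)"]) simp
    then show "\<forall>\<^sub>F n in sequentially. \<exists>y. dist x y < e \<and> s < U n y"
    proof eventually_elim
      case (elim n)
      then obtain y t where yt: "t \<le> U n y" "dist (x, u x) (y, t) < min e (u x - s)"
        by (auto simp: endograph_def)
      then have "dist x y < e" "dist (u x) t < u x - s"
        using dist_fst_le[of "(x, u x)" "(y, t)"] dist_snd_le[of "(x, u x)" "(y, t)"] by auto
      with yt(1) show ?case by (auto simp: dist_real_def intro!: exI[of _ y])
    qed
  qed
next
  assume low: "hypo_lower_bound U u"
  show "endograph u \<subseteq> Kuratowski_liminf (\<lambda>n. endograph (U n))"
  proof (clarsimp simp: endograph_def Kuratowski_liminf_iff_ball)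
    fix x t and e :: real assume t: "0 \<le> t" "t \<le> 1" "t \<le> u x" and e: "0 < e"
    \<comment> \<open>At height \<open>0\<close> there is no smaller admissible height to descend to, but there \<open>(x, 0)\<close> itself
      lies in every endograph.\<close>
    show "\<forall>\<^sub>F n in sequentially. \<exists>y s. 0 \<le> s \<and> s \<le> 1 \<and> s \<le> U n y \<and> dist (x, t) (y, s) < e"
    proof (cases "t = 0")
      case True
      then show ?thesis using assms(2) e
        by (intro always_eventually allI exI[of _ x] exI[of _ 0])
          (auto simp: image_subset_iff)
    next
      case False
      define s where "s = max 0 (t - e / 2)"
      have s: "0 \<le> s" "s < t" "dist t s \<le> e / 2"
        using t e False by (auto simp: s_def dist_real_def max_def)
      have "\<forall>\<^sub>F n in sequentially. \<exists>y. dist x y < e / 2 \<and> s < U n y"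
        by (rule low[unfolded hypo_lower_bound_def, rule_format]) (use s t e in auto)
      then show ?thesis
      proof eventually_elim
        case (elim n)
        then obtain y where "dist x y < e / 2" "s < U n y" by blast
        then show ?case using s t dist_Pair_le[of x t y s]
          by (intro exI[of _ y] exI[of _ s]) auto
      qed
    qed
  qed
qed

text \<open>
  A point \<open>(x, t)\<close> strictly above the graph of \<open>u\<close> stays outside the upper limit exactly when the
  endographs of \<open>U n\<close> eventually avoid a ball around it. Avoiding the points \<open>(y, t)\<close> of that ball
  forces \<open>U n y < t\<close>. Conversely, if \<open>U n\<close> stays below a height \<open>t' < t\<close> near \<open>x\<close>, then its
  endograph misses a ball of radius at most \<open>t - t'\<close>.
\<close>

lemma limsup_subset_endograph_iff:
  assumes "range u \<subseteq> {0..1}" and "\<And>n. range (U n) \<subseteq> {0..1}"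
  shows "Kuratowski_limsup (\<lambda>n. endograph (U n)) \<subseteq> endograph u \<longleftrightarrow> hypo_upper_bound U u"
proof
  assume sub: "Kuratowski_limsup (\<lambda>n. endograph (U n)) \<subseteq> endograph u"
  show "hypo_upper_bound U u"
    unfolding hypo_upper_bound_def
  proof (intro allI impI)
    fix x t assume t: "u x < t"
    show "\<exists>e>0. \<forall>\<^sub>F n in sequentially. \<forall>y. dist x y < e \<longrightarrow> U n y < t"
    proof (cases "t \<le> 1")
      case False
      have "U n y < t" for n y
        using assms(2)[of n] False by (meson atLeastAtMost_iff le_less_trans not_le range_subsetD)
      then show ?thesis by (intro exI[of _ 1]) simp
    next
      case True
      have "0 \<le> u x" using assms(1) by (auto simp: image_subset_iff)
      have "(x, t) \<notin> Kuratowski_limsup (\<lambda>n. endograph (U n))"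
        using t sub by (auto simp: endograph_def)
      then obtain e where e: "e > 0"
        "\<forall>\<^sub>F n in sequentially. \<forall>z\<in>endograph (U n). \<not> dist (x, t) z < e"
        by (auto simp: Kuratowski_limsup_iff_ball not_frequently)
      from e(2) have "\<forall>\<^sub>F n in sequentially. \<forall>y. dist x y < e \<longrightarrow> U n y < t"
      proof eventually_elim
        case (elim n)
        show ?case
        proof (intro allI impI, rule ccontr)
          fix y assume y: "dist x y < e" "\<not> U n y < t"
          then have "(y, t) \<in> endograph (U n)"
            using True t \<open>0 \<le> u x\<close> by (auto simp: endograph_def)
          with elim y show False by (auto simp: dist_Pair_Pair)
        qed
      qed
      with e(1) show ?thesis by blast
    qed
  qed
next
  assume upp: "hypo_upper_bound U u"
  show "Kuratowski_limsup (\<lambda>n. endograph (U n)) \<subseteq> endograph u"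
  proof
    fix z assume z: "z \<in> Kuratowski_limsup (\<lambda>n. endograph (U n))"
    obtain x t where zxt: "z = (x, t)" by (cases z)
    obtain r X where X: "\<And>j. X j \<in> endograph (U (r j))" "X \<longlonglongrightarrow> z"
      using z by (auto simp: Kuratowski_limsup_def)
    have "(\<lambda>j. snd (X j)) \<longlonglongrightarrow> t" using tendsto_snd[OF X(2)] zxt by simp
    moreover have "snd (X j) \<in> {0..1}" for j
      using X(1)[of j] by (auto simp: endograph_def)
    ultimately have t01: "t \<in> {0..1}"
      using closed_sequentially[OF closed_real_atLeastAtMost, of "\<lambda>j. snd (X j)" 0 1 t] by simp
    have "t \<le> u x"
    proof (rule ccontr)
      assume "\<not> t \<le> u x"
      then obtain t' where t': "u x < t'" "t' < t" using dense by (auto simp: not_le)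
      then obtain e where e: "e > 0"
        "\<forall>\<^sub>F n in sequentially. \<forall>y. dist x y < e \<longrightarrow> U n y < t'"
        using upp unfolding hypo_upper_bound_def by blast
      have "\<exists>\<^sub>F n in sequentially. \<exists>w\<in>endograph (U n). dist (x, t) w < min e (t - t')"
        using z e(1) t' unfolding zxt Kuratowski_limsup_iff_ball
      by (elim allE[of _ "min e (t - t')"]) simp
      then have "\<exists>\<^sub>F n in sequentially. False"
        using e(2)
      proof (rule frequently_rev_mp[OF _ eventually_mono])
        fix n assume n: "\<forall>y. dist x y < e \<longrightarrow> U n y < t'"
        show "(\<exists>w\<in>endograph (U n). dist (x, t) w < min e (t - t')) \<longrightarrow> False"
        proof clarify
          fix y s assume ys: "(y, s) \<in> endograph (U n)" "dist (x, t) (y, s) < min e (t - t')"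
          then have "dist x y < e" "dist t s < t - t'"
            using dist_fst_le[of "(x, t)" "(y, s)"] dist_snd_le[of "(x, t)" "(y, s)"] by auto
          with n ys(1) show False by (fastforce simp: endograph_def dist_real_def)
        qed
      qed
      then show False by simp
    qed
    with t01 zxt show "z \<in> endograph u" by (auto simp: endograph_def)
  qed
qed

lemma Gamma_converges_iff_hypo_bounds:
  assumes "range u \<subseteq> {0..1}" and "\<And>n. range (U n) \<subseteq> {0..1}"
  shows "Gamma_converges U u \<longleftrightarrow> hypo_lower_bound U u \<and> hypo_upper_bound U u"
  unfolding Gamma_converges_def Kuratowski_converges_iff_subsets
  using endograph_subset_liminf_iff[OF assms] limsup_subset_endograph_iff[OF assms] by simp

section \<open>Convergence of level sets\<close>

lemma alpha_cut_subset_liminf_iff: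
  "alpha_cut u \<alpha> \<subseteq> Kuratowski_liminf (\<lambda>n. alpha_cut (U n) \<alpha>) \<longleftrightarrow>
    (\<forall>x e. \<alpha> \<le> u x \<longrightarrow> 0 < e \<longrightarrow> (\<forall>\<^sub>F n in sequentially. \<exists>y. dist x y < e \<and> \<alpha> \<le> U n y))"
proof -
  have "(\<exists>y\<in>alpha_cut (U n) \<alpha>. dist x y < e) \<longleftrightarrow> (\<exists>y. dist x y < e \<and> \<alpha> \<le> U n y)" for n x e
    by (auto simp: alpha_cut_def)
  moreover have "x \<in> alpha_cut u \<alpha> \<longleftrightarrow> \<alpha> \<le> u x" for x
    by (simp add: alpha_cut_def)
  ultimately show ?thesis by (simp add: subset_iff Kuratowski_liminf_iff_ball)
qed

lemma limsup_subset_alpha_cut_iff: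
  "Kuratowski_limsup (\<lambda>n. alpha_cut (U n) \<alpha>) \<subseteq> alpha_cut u \<alpha> \<longleftrightarrow>
    (\<forall>x. u x < \<alpha> \<longrightarrow> (\<exists>e>0. \<forall>\<^sub>F n in sequentially. \<forall>y. dist x y < e \<longrightarrow> U n y < \<alpha>))"
proof -
  define dominated where
    "dominated x \<longleftrightarrow> (\<exists>e>0. \<forall>\<^sub>F n in sequentially. \<forall>y. dist x y < e \<longrightarrow> U n y < \<alpha>)" for x
  have "(\<exists>y\<in>alpha_cut (U n) \<alpha>. dist x y < e) \<longleftrightarrow>
      \<not> (\<forall>y. dist x y < e \<longrightarrow> U n y < \<alpha>)" for n x e
    by (auto simp: alpha_cut_def not_less)
  then have "x \<in> Kuratowski_limsup (\<lambda>n. alpha_cut (U n) \<alpha>) \<longleftrightarrow> \<not> dominated x" for x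
    by (simp add: Kuratowski_limsup_iff_ball frequently_def dominated_def)
  moreover have "x \<in> alpha_cut u \<alpha> \<longleftrightarrow> \<not> u x < \<alpha>" for x
    by (auto simp: alpha_cut_def)
  ultimately show ?thesis unfolding dominated_def[symmetric] by blast
qed

lemma closed_alpha_cut:
  assumes "upper_semicontinuous u"
  shows "closed (alpha_cut u \<alpha>)"
proof -
  have "open (- alpha_cut u \<alpha>)"
    unfolding open_subopen[of "- alpha_cut u \<alpha>"]
  proof
    fix x assume "x \<in> - alpha_cut u \<alpha>"
    then have "\<forall>\<^sub>F y in nhds x. u y < \<alpha>"
      using assms by (auto simp: upper_semicontinuous_def alpha_cut_def)
    then show "\<exists>T. open T \<and> x \<in> T \<and> T \<subseteq> - alpha_cut u \<alpha>"
      unfolding eventually_nhds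
      by (elim exE conjE, intro exI conjI) (auto simp: alpha_cut_def)
  qed
  then show ?thesis by (simp add: closed_def)
qed

text \<open>
  A point at height exactly \<open>\<alpha>\<close> can first be moved into \<open>{u > \<alpha>}\<close>: the cut \<open>{u \<ge> \<alpha>}\<close> is closed, so
  it contains the closure of \<open>{u > \<alpha>}\<close>, and since \<open>\<alpha>\<close> is not a platform point the two coincide.
  The lower bound then applies to the strict inequality at the new point.
\<close>

lemma hypo_bounds_imp_alpha_cut_converges:
  assumes usc: "upper_semicontinuous u"
    and low: "hypo_lower_bound U u" and upp: "hypo_upper_bound U u"
    and \<alpha>: "\<alpha> \<in> {0<..<1} - platform_points u"
  shows "Kuratowski_converges (\<lambda>n. alpha_cut (U n) \<alpha>) (alpha_cut u \<alpha>)"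
  unfolding Kuratowski_converges_iff_subsets alpha_cut_subset_liminf_iff
    limsup_subset_alpha_cut_iff
proof (intro conjI allI impI)
  fix x assume "u x < \<alpha>"
  with upp show "\<exists>e>0. \<forall>\<^sub>F n in sequentially. \<forall>y. dist x y < e \<longrightarrow> U n y < \<alpha>"
    unfolding hypo_upper_bound_def by blast
next
  fix x and e :: real assume x: "\<alpha> \<le> u x" and e: "0 < e"
  have "closure (strict_alpha_cut u \<alpha>) \<subseteq> alpha_cut u \<alpha>"
    by (rule closure_minimal[OF _ closed_alpha_cut[OF usc]])
      (auto simp: strict_alpha_cut_def alpha_cut_def)
  with \<alpha> have "closure (strict_alpha_cut u \<alpha>) = alpha_cut u \<alpha>"
    by (auto simp: platform_points_def)
  with x have "x \<in> closure (strict_alpha_cut u \<alpha>)"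
    by (simp add: alpha_cut_def)
  then obtain x' where x': "\<alpha> < u x'" "dist x' x < e / 2"
    using e unfolding closure_approachable strict_alpha_cut_def by (auto dest!: spec[of _ "e / 2"])
  then have "\<forall>\<^sub>F n in sequentially. \<exists>y. dist x' y < e / 2 \<and> \<alpha> < U n y"
    using e by (intro low[unfolded hypo_lower_bound_def, rule_format]) auto
  then show "\<forall>\<^sub>F n in sequentially. \<exists>y. dist x y < e \<and> \<alpha> \<le> U n y"
  proof eventually_elim
    case (elim n)
    then obtain y where "dist x' y < e / 2" "\<alpha> < U n y" by blast
    then show ?case
      using x' dist_triangle[of x y x'] by (intro exI[of _ y]) (auto simp: dist_commute)
  qed
qed

text \<open>
  Between \<open>u x\<close> and a height to be compared with it there is room for a height \<open>\<alpha>\<close> from \<open>D\<close>, and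
  convergence of the \<open>\<alpha>\<close>-cuts gives the required bound there. Heights below \<open>0\<close> or above \<open>1\<close> are
  treated separately, as \<open>D\<close> need not reach them; for them the bounds hold trivially.
\<close>

lemma Gamma_converges_if_alpha_cuts_converge_densely:
  assumes "range u \<subseteq> {0..1}" and "\<And>n. range (U n) \<subseteq> {0..1}"
    and conv: "\<And>\<alpha>. \<alpha> \<in> D \<Longrightarrow> Kuratowski_converges (\<lambda>n. alpha_cut (U n) \<alpha>) (alpha_cut u \<alpha>)"
    and dense: "\<And>a b. 0 \<le> a \<Longrightarrow> a < b \<Longrightarrow> b \<le> 1 \<Longrightarrow> \<exists>\<alpha>\<in>D. a < \<alpha> \<and> \<alpha> < b"
  shows "Gamma_converges U u"
proof -
  have u01: "0 \<le> u x" "u x \<le> 1" and U01: "0 \<le> U n x" "U n x \<le> 1" for n x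
    using assms(1,2) by (auto simp: image_subset_iff)
  have "hypo_lower_bound U u"
    unfolding hypo_lower_bound_def
  proof (intro allI impI)
    fix x s and e :: real assume s: "s < u x" and e: "0 < e"
    show "\<forall>\<^sub>F n in sequentially. \<exists>y. dist x y < e \<and> s < U n y"
    proof (cases "s < 0")
      case True
      then show ?thesis
        using e less_le_trans[OF _ U01(1)] by (intro always_eventually allI exI[of _ x]) simp
    next
      case False
      then obtain \<alpha> where \<alpha>: "\<alpha> \<in> D" "s < \<alpha>" "\<alpha> < u x"
        using dense[of s "u x"] s u01 by auto
      then have "\<forall>\<^sub>F n in sequentially. \<exists>y. dist x y < e \<and> \<alpha> \<le> U n y"
        using conv[OF \<alpha>(1)] e
        unfolding Kuratowski_converges_iff_subsets alpha_cut_subset_liminf_iff by simp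
      then show ?thesis by eventually_elim (use \<alpha>(2) in force)
    qed
  qed
  moreover have "hypo_upper_bound U u"
    unfolding hypo_upper_bound_def
  proof (intro allI impI)
    fix x t assume t: "u x < t"
    show "\<exists>e>0. \<forall>\<^sub>F n in sequentially. \<forall>y. dist x y < e \<longrightarrow> U n y < t"
    proof (cases "t > 1")
      case True
      have "U n y < t" for n y using U01(2)[of n y] True by linarith
      then show ?thesis by (intro exI[of _ 1]) simp
    next
      case False
      then obtain \<alpha> where \<alpha>: "\<alpha> \<in> D" "u x < \<alpha>" "\<alpha> < t"
        using dense[of "u x" t] t u01 by auto
      then obtain e where e: "e > 0"
        "\<forall>\<^sub>F n in sequentially. \<forall>y. dist x y < e \<longrightarrow> U n y < \<alpha>"
        using conv[OF \<alpha>(1)]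
        unfolding Kuratowski_converges_iff_subsets limsup_subset_alpha_cut_iff by blast
      from e(2) have "\<forall>\<^sub>F n in sequentially. \<forall>y. dist x y < e \<longrightarrow> U n y < t"
        by eventually_elim (use \<alpha>(3) in force)
      with e(1) show ?thesis by blast
    qed
  qed
  ultimately show ?thesis using Gamma_converges_iff_hypo_bounds[OF assms(1,2)] by simp
qed

section \<open>Dense sets of heights\<close>

text \<open>
  If \<open>\<alpha>\<close> is a platform point, some \<open>x\<close> at height \<open>\<alpha>\<close> has a neighbourhood on which \<open>u\<close> never
  exceeds \<open>\<alpha>\<close>. Shrunk to a member of a countable base, this neighbourhood determines \<open>\<alpha>\<close> as the
  maximum of \<open>u\<close> on it.
\<close>

lemma countable_platform_points:
  fixes u :: "'a::second_countable_topology \<Rightarrow> real"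
  shows "countable (platform_points u)"
proof -
  obtain B :: "'a set set" where B: "countable B" "topological_basis B"
    using ex_countable_basis by blast
  have "platform_points u \<subseteq> (\<lambda>W. Sup (u ` W)) ` B"
  proof
    fix \<alpha> assume "\<alpha> \<in> platform_points u"
    then obtain x where x: "\<alpha> \<le> u x" "x \<in> - closure (strict_alpha_cut u \<alpha>)"
      by (auto simp: platform_points_def alpha_cut_def)
    then obtain W where W: "W \<in> B" "x \<in> W" "W \<subseteq> - closure (strict_alpha_cut u \<alpha>)"
      using topological_basisE[OF B(2) _ x(2)] open_Compl[OF closed_closure] by metis
    then have le: "u y \<le> \<alpha>" if "y \<in> W" for y
    proof -
      have "y \<notin> strict_alpha_cut u \<alpha>"
        using that W(3) closure_subset[of "strict_alpha_cut u \<alpha>"] by blast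
      then show ?thesis by (simp add: strict_alpha_cut_def)
    qed
    have "Sup (u ` W) = \<alpha>"
      using x(1) W(2) le by (intro cSup_eq_maximum) (auto intro: antisym)
    with W(1) show "\<alpha> \<in> (\<lambda>W. Sup (u ` W)) ` B" by blast
  qed
  then show ?thesis using B(1) countable_subset by blast
qed

lemma ex_in_interval_if_dense_in_cocountable:
  fixes a b :: real
  assumes "countable S" and P: "dense_subset P ({0<..<1} - S)"
    and ab: "0 \<le> a" "a < b" "b \<le> 1"
  shows "\<exists>\<alpha>\<in>P. a < \<alpha> \<and> \<alpha> < b"
proof -
  have "uncountable ({a<..<b} - S)"
    using assms(1) ab(2) uncountable_minus_countable uncountable_open_interval by blast
  then obtain c where c: "c \<in> {a<..<b} - S" by (metis countable_empty ex_in_conv)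
  with ab P have "c \<in> closure P" by (auto simp: dense_subset_def subset_iff)
  moreover have "open {a<..<b}" "c \<in> {a<..<b}" using c by auto
  ultimately have "P \<inter> {a<..<b} \<noteq> {}"
    using open_Int_closure_eq_empty[of "{a<..<b}" P] by blast
  then show ?thesis by auto
qed

lemma ex_in_interval_if_AE:
  fixes a b :: real
  assumes "AE \<alpha> in lebesgue. \<alpha> \<in> {0<..<1} \<longrightarrow> Q \<alpha>" and ab: "0 \<le> a" "a < b" "b \<le> 1"
  shows "\<exists>\<alpha>\<in>{\<alpha>. Q \<alpha>}. a < \<alpha> \<and> \<alpha> < b"
proof (rule ccontr)
  assume "\<not> ?thesis"
  then have none: "\<And>\<alpha>. \<alpha> \<in> {a<..<b} \<Longrightarrow> \<not> Q \<alpha>" by auto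
  have "AE \<alpha> in lebesgue. \<alpha> \<notin> {a<..<b}"
    using assms(1) by (rule AE_mp) (use none ab in \<open>auto intro!: AE_I2\<close>)
  then have "{a<..<b} \<in> null_sets lebesgue"
    by (subst AE_iff_null_sets) auto
  then have "negligible {a<..<b}" by (simp add: negligible_iff_null_sets)
  then show False using ab(2) open_not_negligible[of "{a<..<b}"] by auto
qed

section \<open>Equivalence of the five conditions\<close>

theorem theorem6p2:
  fixes u :: "real ^ 'm \<Rightarrow> real" and U :: "nat \<Rightarrow> real ^ 'm \<Rightarrow> real"
  assumes "u \<in> F_USC" and "\<And>n. U n \<in> F_USC"
  shows "(Gamma_converges U u \<longleftrightarrow>
            (AE \<alpha> in lebesgue. \<alpha> \<in> {0<..<1} \<longrightarrow>
             Kuratowski_converges (\<lambda>n. alpha_cut (U n) \<alpha>) (alpha_cut u \<alpha>))) \<and>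
          (Gamma_converges U u \<longleftrightarrow>
            (\<forall>\<alpha> \<in> {0<..<1} - platform_points u.
             Kuratowski_converges (\<lambda>n. alpha_cut (U n) \<alpha>) (alpha_cut u \<alpha>))) \<and>
          (Gamma_converges U u \<longleftrightarrow>
            (\<exists>P. dense_subset P ({0<..<1} - platform_points u) \<and>
             (\<forall>\<alpha> \<in> P. Kuratowski_converges (\<lambda>n. alpha_cut (U n) \<alpha>) (alpha_cut u \<alpha>)))) \<and>
          (Gamma_converges U u \<longleftrightarrow>
            (\<exists>P. countable P \<and> dense_subset P ({0<..<1} - platform_points u) \<and>
             (\<forall>\<alpha> \<in> P. Kuratowski_converges (\<lambda>n. alpha_cut (U n) \<alpha>) (alpha_cut u \<alpha>))))"
proof -
  let ?conv = "\<lambda>\<alpha>. Kuratowski_converges (\<lambda>n. alpha_cut (U n) \<alpha>) (alpha_cut u \<alpha>)"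
  let ?R = "{0<..<1} - platform_points u"
  have u: "range u \<subseteq> {0..1}" "upper_semicontinuous u" and U: "\<And>n. range (U n) \<subseteq> {0..1}"
    using assms by (auto simp: F_USC_def)
  have "platform_points u \<in> null_sets lebesgue"
    using countable_imp_null_set_lborel[OF countable_platform_points[of u]]
    by (rule null_sets_completionI)
  then have AE: "AE \<alpha> in lebesgue. \<alpha> \<in> {0<..<1} \<longrightarrow> ?conv \<alpha>" if "\<forall>\<alpha>\<in>?R. ?conv \<alpha>"
    by (rule AE_mp[OF AE_not_in]) (use that in \<open>auto intro!: AE_I2\<close>)
  have all: "\<forall>\<alpha>\<in>?R. ?conv \<alpha>" if "Gamma_converges U u"
  proof
    have bounds: "hypo_lower_bound U u" "hypo_upper_bound U u"
      using that Gamma_converges_iff_hypo_bounds[OF u(1) U] by simp_all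
    show "?conv \<alpha>" if "\<alpha> \<in> ?R" for \<alpha>
      using hypo_bounds_imp_alpha_cut_converges[OF u(2) bounds that] .
  qed
  obtain Q where Q: "countable Q" "dense_subset Q ?R"
    unfolding dense_subset_def by (rule separable[of ?R]) simp
  have from_dense: "Gamma_converges U u" if "dense_subset P ?R" "\<forall>\<alpha>\<in>P. ?conv \<alpha>" for P
    by (rule Gamma_converges_if_alpha_cuts_converge_densely
        [OF u(1) U _ ex_in_interval_if_dense_in_cocountable[OF countable_platform_points that(1)]])
      (use that(2) in simp_all)
  have from_AE: "Gamma_converges U u" if "AE \<alpha> in lebesgue. \<alpha> \<in> {0<..<1} \<longrightarrow> ?conv \<alpha>"
    by (rule Gamma_converges_if_alpha_cuts_converge_densely
        [OF u(1) U _ ex_in_interval_if_AE[OF that]]) simp_all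
  have Q_conv: "\<forall>\<alpha>\<in>Q. ?conv \<alpha>" if "Gamma_converges U u"
    using all[OF that] Q(2) by (auto simp: dense_subset_def)
  have "dense_subset ?R ?R" by (simp add: dense_subset_def closure_subset)
  then have from_all: "Gamma_converges U u" if "\<forall>\<alpha>\<in>?R. ?conv \<alpha>"
    using from_dense that by blast
  show ?thesis
  proof (intro conjI)
    show "Gamma_converges U u \<longleftrightarrow> (AE \<alpha> in lebesgue. \<alpha> \<in> {0<..<1} \<longrightarrow> ?conv \<alpha>)"
      using AE[OF all] from_AE by (rule iffI)
    show "Gamma_converges U u \<longleftrightarrow> (\<forall>\<alpha>\<in>?R. ?conv \<alpha>)"
      using all from_all by (rule iffI)
    show "Gamma_converges U u \<longleftrightarrow> (\<exists>P. dense_subset P ?R \<and> (\<forall>\<alpha>\<in>P. ?conv \<alpha>))"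
      by (rule iffI, intro exI[of _ Q] conjI Q(2) Q_conv, assumption)
        (elim exE conjE, rule from_dense)
    show "Gamma_converges U u \<longleftrightarrow>
        (\<exists>P. countable P \<and> dense_subset P ?R \<and> (\<forall>\<alpha>\<in>P. ?conv \<alpha>))"
      by (rule iffI, intro exI[of _ Q] conjI Q Q_conv, assumption)
        (elim exE conjE, rule from_dense)
  qed
qed

end
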